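(* The trivial solution $x(t)\equiv 0$ of the system $\frac{dx}{dt}=f(x,t)$ is $\{G_0,\Phi_t,t_0,T\}$-stable if and only if there exists a continuous function $V:\mathbb{R}^n\times[t_0,T]\to\mathbb{R}$, $(x,t)\mapsto V(x,t)$, which is nonincreasing along the solutions of the system (that is, $t\mapsto V(x(t),t)$ is nonincreasing on $[t_0,T]$ for every solution $x(\cdot)$), such that $$\{x\in\mathbb{R}^n: V(x,t)\le 1\}\subseteq \Phi_t \quad\text{for all } t\in[t_0,T],$$ $$G_0\subseteq\{x\in\mathbb{R}^n: V(x,t_0)\le 1\}.$$
   Context: Let $n\ge 1$ and $t_0<T$. Consider the system of ordinary differential equations $\frac{dx}{dt}=f(x,t)$, $x\in\mathbb{R}^n$, $t\in[t_0,T]$, where $f:\mathbb{R}^n\times[t_0,T]\to\mathbb{R}^n$ satisfies the conditions of the existence and uniqueness theorem: $f$ is continuous, locally Lipschitz in $x$, and for every $s\in[t_0,T]$ and $\xi\in\mathbb{R}^n$ there is a unique solution with $x(s)=\xi$, defined on all of $[t_0,T]$. Moreover $f(0,t)=0$ for all $t\in[t_0,T]$. Denote by $x(t,x_0,t_0)$ the solution with $x(t_0)=x_0$. For each $t\in[t_0,T]$ let $\Phi_t\subset\mathbb{R}^n$ be a compact set with $0\in\Phi_t$ (no regularity in $t$ is assumed). Let $G_0\subseteq\Phi_{t_0}$ with $0\in G_0$. Definition. The solution $x(t)\equiv 0$ is said to be $\{G_0,\Phi_t,t_0,T\}$-stable if $x(t,x_0,t_0)\in\Phi_t$ for all $t\in[t_0,T]$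 whenever $x_0\in G_0$. *)

theory Defs
  imports "HOL-Analysis.Analysis"
begin

text \<open>
  Solutions of \<open>x' = f(x,t)\<close> on \<open>[t0, T]\<close>. Functions are total in HOL: only the values of
  \<open>x\<close> on \<open>[t0, T]\<close> matter, and at the endpoints the derivative is one-sided.
\<close>

definition ode_solution ::
  "((real ^ 'n) \<Rightarrow> real \<Rightarrow> real ^ 'n) \<Rightarrow> real \<Rightarrow> real \<Rightarrow> (real \<Rightarrow> real ^ 'n) \<Rightarrow> bool" where
  "ode_solution f t0 T x \<longleftrightarrow>
     (\<forall>t\<in>{t0..T}. (x has_vector_derivative f (x t) t) (at t within {t0..T}))"

text \<open>
  \<open>ode_flow f t0 T t \<xi> s\<close> is the value \<open>x(t, \<xi>, s)\<close> at time \<open>t\<close> of the solution on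
  \<open>[t0, T]\<close> that passes through \<open>\<xi>\<close> at time \<open>s\<close>. The value, rather than the function, is
  described, since a solution is determined on \<open>[t0, T]\<close> only. It is meaningful for
  \<open>s\<close> and \<open>t\<close> in \<open>[t0, T]\<close> when such a solution exists and is unique on \<open>[t0, T]\<close>.
\<close>

definition ode_flow ::
  "((real ^ 'n) \<Rightarrow> real \<Rightarrow> real ^ 'n) \<Rightarrow> real \<Rightarrow> real \<Rightarrow> real \<Rightarrow> real ^ 'n \<Rightarrow> real \<Rightarrow> real ^ 'n" where
  "ode_flow f t0 T t \<xi> s = (THE y. \<exists>x. ode_solution f t0 T x \<and> x s = \<xi> \<and> x t = y)"

definition practically_stable ::
  "((real ^ 'n) \<Rightarrow> real \<Rightarrow> real ^ 'n) \<Rightarrow> (real ^ 'n) set \<Rightarrow> (real \<Rightarrow> (real ^ 'n) set) \<Rightarrow>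
   real \<Rightarrow> real \<Rightarrow> bool" where
  "practically_stable f G0 \<Phi> t0 T \<longleftrightarrow>
     (\<forall>x0\<in>G0. \<forall>t\<in>{t0..T}. ode_flow f t0 T t x0 t0 \<in> \<Phi> t)"

end

theory Submission
  imports Defs
begin

text \<open>
  The Lyapunov function is \<open>V(x, t) = 1 + dist(x(t\<^sub>0, x, t), G\<^sub>0)\<close>: transport \<open>x\<close> back to time
  \<open>t\<^sub>0\<close> and measure how far it lands from \<open>G\<^sub>0\<close>. It is constant along solutions, its sublevel set
  \<open>V \<le> 1\<close> is the flow image of the closure of \<open>G\<^sub>0\<close>, and continuous dependence on
  the data makes \<open>V\<close> continuous and keeps that image inside the closed sets \<open>\<Phi>\<^sub>t\<close>.
\<close>

section \<open>Gronwall estimates confined to the unit ball\<close>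

text \<open>
  The growth condition is only available while \<open>u\<close> is in the unit ball;
  at a first exit time the estimate itself would already exclude the exit.
\<close>

lemma gronwall_unit_ball:
  fixes u :: "real \<Rightarrow> 'a :: real_inner"
  assumes der: "\<And>t. t \<in> {a..b} \<Longrightarrow> (u has_vector_derivative g t) (at t within {a..b})"
    and growth: "\<And>t. t \<in> {a..b} \<Longrightarrow> norm (u t) \<le> 1 \<Longrightarrow> norm (g t) \<le> L * norm (u t)"
    and small: "norm (u a) * exp (L * (b - a)) < 1" and "0 \<le> L"
    and t: "t \<in> {a..b}"
  shows "norm (u t) \<le> norm (u a) * exp (L * (t - a))"
proof -
  have cont: "continuous_on {a..b} u"
    using der by (rule continuous_on_vector_derivative)
  \<comment> \<open>A conditional estimate for a bootstrap: it is applied first at the earliest exit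
    time, to exclude the exit, and then at the given time \<open>t\<close>.\<close>
  have est: "norm (u c) \<le> norm (u a) * exp (L * (c - a))"
    if c: "c \<in> {a..b}" and ball: "\<And>r. r \<in> {a..c} \<Longrightarrow> norm (u r) \<le> 1" for c
  proof -
    \<comment> \<open>The squared norm stays differentiable where \<open>u\<close> vanishes, unlike
      the norm. The factor is the integrating factor for the growth rate \<open>2 * L\<close> of the
      square.\<close>
    define w where "w r = (u r \<bullet> u r) * exp (- (2 * L * (r - a)))" for r
    have "w c \<le> w a"
    \<comment> \<open>This criterion asks for derivatives only in the open interval, where the
      derivative within \<open>{a..b}\<close> is two-sided; at the endpoints continuity
      suffices.\<close>
    proof (rule DERIV_nonpos_imp_decreasing_open[where f = w])
      show "a \<le> c" using c by simp
      show "continuous_on {a..c} w"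
        unfolding w_def using c by (intro continuous_intros continuous_on_subset[OF cont]) auto
    next
      fix r assume r: "a < r" "r < c"
      have "at r within {a..b} = at r" using r c by (intro at_within_interior) auto
      then have u': "(u has_derivative (\<lambda>h. h *\<^sub>R g r)) (at r)"
        using der[of r] r c by (simp add: has_vector_derivative_def)
      have "((\<lambda>r. u r \<bullet> u r) has_real_derivative 2 * (u r \<bullet> g r)) (at r)"
        unfolding has_field_derivative_def
        by (rule has_derivative_eq_rhs[OF has_derivative_inner[OF u' u']])
           (auto simp: fun_eq_iff inner_commute)
      moreover have "((\<lambda>r. exp (- (2 * L * (r - a)))) has_real_derivative
          exp (- (2 * L * (r - a))) * (- 2 * L)) (at r)"
        by (auto intro!: derivative_eq_intros)
      ultimately have "(w has_real_derivative
          2 * (u r \<bullet> g r) * exp (- (2 * L * (r - a))) +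
          exp (- (2 * L * (r - a))) * (- 2 * L) * (u r \<bullet> u r)) (at r)"
        unfolding w_def by (rule DERIV_mult)
      moreover have "u r \<bullet> g r \<le> L * (u r \<bullet> u r)"
      proof -
        have "u r \<bullet> g r \<le> norm (u r) * norm (g r)" by (rule norm_cauchy_schwarz)
        also have "\<dots> \<le> norm (u r) * (L * norm (u r))"
          using growth[of r] ball[of r] r c by (intro mult_left_mono) auto
        also have "\<dots> = L * (u r \<bullet> u r)" by (simp add: dot_square_norm power2_eq_square)
        finally show ?thesis .
      qed
      then have "(u r \<bullet> g r - L * (u r \<bullet> u r)) * (2 * exp (- (2 * L * (r - a)))) \<le> 0"
        by (intro mult_nonpos_nonneg) auto
      then have "2 * (u r \<bullet> g r) * exp (- (2 * L * (r - a))) +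
          exp (- (2 * L * (r - a))) * (- 2 * L) * (u r \<bullet> u r) \<le> 0"
        by (simp add: algebra_simps)
      ultimately show "\<exists>y. (w has_real_derivative y) (at r) \<and> y \<le> 0" by blast
    qed
    then have "u c \<bullet> u c \<le> (u a \<bullet> u a) * exp (2 * L * (c - a))"
      by (simp add: w_def exp_minus divide_le_eq flip: divide_inverse)
    also have "\<dots> = (norm (u a) * exp (L * (c - a)))\<^sup>2"
      by (simp add: dot_square_norm power_mult_distrib mult.assoc flip: exp_double)
    finally have "(norm (u c))\<^sup>2 \<le> (norm (u a) * exp (L * (c - a)))\<^sup>2"
      by (simp add: dot_square_norm)
    then show ?thesis by (rule power2_le_imp_le) simp
  qed
  have inside: "norm (u r) < 1" if r: "r \<in> {a..b}" for r
  proof (rule ccontr)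
    assume "\<not> norm (u r) < 1"
    \<comment> \<open>The times at which \<open>u\<close> is outside the open unit ball form a
      compact set, so there is an earliest one, \<open>m\<close>. Before \<open>m\<close> the norm
      is below 1.\<close>
    define S where "S = {a..b} \<inter> (\<lambda>r. norm (u r)) -` {1..}"
    have "closed S"
      unfolding S_def by (intro continuous_closed_preimage continuous_on_norm cont) auto
    moreover have "bounded S" by (rule bounded_subset[of "{a..b}"]) (auto simp: S_def)
    moreover have "S \<noteq> {}" using r \<open>\<not> norm (u r) < 1\<close> by (auto simp: S_def)
    ultimately obtain m where m: "m \<in> S" "\<And>q. q \<in> S \<Longrightarrow> m \<le> q"
      using compact_attains_inf[of S] by (auto simp: compact_eq_bounded_closed)
    have mab: "m \<in> {a..b}" using m(1) by (simp add: S_def)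
    have low: "norm (u q) \<le> 1" if "q \<in> {a..<m}" for q
      using m(2)[of q] that mab by (force simp: S_def)
    have "norm (u m) < 1"
    \<comment> \<open>If \<open>a = m\<close>, then \<open>{a..<m}\<close> is empty and
      \<open>small\<close> bounds the initial value directly. Otherwise the bound on
      \<open>{a..<m}\<close> passes to \<open>m\<close> by continuity, so that \<open>est\<close>
      applies at \<open>m\<close> itself.\<close>
    proof (cases "a = m")
      case True
      have "norm (u a) * 1 \<le> norm (u a) * exp (L * (b - a))"
        using \<open>0 \<le> L\<close> mab by (intro mult_left_mono) auto
      with small True show ?thesis by simp
    next
      case False
      have "norm (u q) \<le> 1" if "q \<in> {a..m}" for q
      proof (rule continuous_le_on_closure[of "{a..<m}" "\<lambda>q. norm (u q)"])
        show "continuous_on (closure {a..<m}) (\<lambda>q. norm (u q))"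
          using False mab
          by (auto intro!: continuous_on_norm continuous_on_subset[OF cont])
        show "q \<in> closure {a..<m}" using that False by simp
      qed (rule low)
      then have "norm (u m) \<le> norm (u a) * exp (L * (m - a))" by (intro est mab)
      also have "\<dots> \<le> norm (u a) * exp (L * (b - a))"
        using \<open>0 \<le> L\<close> mab by (intro mult_left_mono) (auto intro!: mult_left_mono)
      finally show ?thesis using small by simp
    qed
    with m(1) show False by (simp add: S_def)
  qed
  show ?thesis
    using t inside by (intro est) (auto intro: less_imp_le)
qed

text \<open>Reversing time exchanges the endpoints and changes only the sign of the derivative,
  which the norm ignores. This version propagates closeness from \<open>s\<close> to earlier
  times.\<close>

lemma gronwall_unit_ball_backward:
  fixes u :: "real \<Rightarrow> 'a :: real_inner"
  assumes der: "\<And>t. t \<in> {a..b} \<Longrightarrow> (u has_vector_derivative g t) (at t within {a..b})"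
    and growth: "\<And>t. t \<in> {a..b} \<Longrightarrow> norm (u t) \<le> 1 \<Longrightarrow> norm (g t) \<le> L * norm (u t)"
    and small: "norm (u b) * exp (L * (b - a)) < 1" and "0 \<le> L"
    and t: "t \<in> {a..b}"
  shows "norm (u t) \<le> norm (u b) * exp (L * (b - t))"
proof -
  have "norm ((u \<circ> uminus) (- t)) \<le> norm ((u \<circ> uminus) (- b)) * exp (L * (- t - (- b)))"
  proof (rule gronwall_unit_ball[where b = "- a" and g = "\<lambda>t. - g (- t)"])
    fix r assume r: "r \<in> {- b..- a}"
    have "(u has_vector_derivative g (- r)) (at (- r) within uminus ` {- b..- a})"
      using der[of "- r"] r by simp
    then have "((u \<circ> uminus) has_vector_derivative (-1) *\<^sub>R g (- r)) (at r within {- b..- a})"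
      by (intro vector_diff_chain_within) (auto intro!: derivative_eq_intros)
    then show "((u \<circ> uminus) has_vector_derivative - g (- r)) (at r within {- b..- a})"
      by simp
  qed (use assms in auto)
  then show ?thesis by simp
qed

section \<open>Continuous dependence on the initial data\<close>

lemma ode_solution_continuous_on: "ode_solution f t0 T x \<Longrightarrow> continuous_on {t0..T} x"
  by (rule continuous_on_vector_derivative[where f' = "\<lambda>t. f (x t) t"]) (simp add: ode_solution_def)

text \<open>While \<open>y\<close> is within distance 1 of \<open>x\<close>, both lie in a fixed
  ball on which \<open>f\<close> has one Lipschitz constant for all times, so \<open>y - x\<close>
  obeys the confined Gronwall estimate. Choosing \<open>d\<close> before \<open>y\<close>,
  \<open>s\<close> and \<open>t\<close> is what later lets the initial time vary.\<close>

lemma ode_solution_continuous_dependence: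
  fixes f :: "(real ^ 'n) \<Rightarrow> real \<Rightarrow> real ^ 'n"
  assumes f_continuous: "continuous_on (UNIV \<times> {t0..T}) (\<lambda>(x, t). f x t)"
    and f_lipschitz: "local_lipschitz {t0..T} UNIV (\<lambda>t x. f x t)"
    and x: "ode_solution f t0 T x" and "0 < e"
  obtains d where "0 < d"
    and "\<And>y s t. ode_solution f t0 T y \<Longrightarrow> s \<in> {t0..T} \<Longrightarrow> t \<in> {t0..T} \<Longrightarrow>
           dist (y s) (x s) < d \<Longrightarrow> dist (y t) (x t) < e"
proof -
  have "bounded (x ` {t0..T})"
    by (intro compact_imp_bounded compact_continuous_image ode_solution_continuous_on[OF x]) simp
  then obtain B where B: "\<And>t. t \<in> {t0..T} \<Longrightarrow> norm (x t) \<le> B"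
    unfolding bounded_iff by blast
  \<comment> \<open>Continuity in time at fixed \<open>z\<close> is a premise for passing from local
    Lipschitz constants to a single one on compact sets.\<close>
  have "continuous_on {t0..T} (\<lambda>t. f z t)" for z
    by (rule continuous_on_compose2[OF f_continuous, of _ "\<lambda>t. (z, t)", simplified])
       (auto intro!: continuous_intros)
  then obtain L where L: "\<And>t. t \<in> {t0..T} \<Longrightarrow> L-lipschitz_on (cball 0 (B + 1)) (\<lambda>z. f z t)"
    using local_lipschitz_compact_implies_lipschitz[OF
        local_lipschitz_subset[OF f_lipschitz order_refl subset_UNIV] compact_cball compact_Icc]
    by blast
  define M where "M = exp (L * (T - t0))"
  \<comment> \<open>\<open>M\<close> bounds the exponential growth over all of
    \<open>[t0, T]\<close>. The 1 in the minimum keeps the difference inside the unit ball, the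
    \<open>e\<close> gives the required accuracy.\<close>
  define d where "d = min 1 e / M"
  have "0 < M" by (simp add: M_def)
  show thesis
  proof
    show "0 < d" using \<open>0 < e\<close> \<open>0 < M\<close> by (simp add: d_def)
    fix y s t
    assume y: "ode_solution f t0 T y" and s: "s \<in> {t0..T}" and t: "t \<in> {t0..T}"
      and close: "dist (y s) (x s) < d"
    have "0 \<le> L" using L[OF s] by (rule lipschitz_on_nonneg)
    define u where "u r = y r - x r" for r
    define g where "g r = f (y r) r - f (x r) r" for r
    \<comment> \<open>Subintervals are allowed because the estimate is run on \<open>{s..t}\<close>
      or on \<open>{t..s}\<close>, depending on the order of \<open>s\<close> and
      \<open>t\<close>.\<close>
    have der: "(u has_vector_derivative g r) (at r within {a..b})"
      if "r \<in> {a..b}" "{a..b} \<subseteq> {t0..T}" for r a b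
    proof (rule has_vector_derivative_within_subset[OF _ that(2)])
      show "(u has_vector_derivative g r) (at r within {t0..T})"
        unfolding u_def g_def using x y that
        by (intro has_vector_derivative_diff) (auto simp: ode_solution_def)
    qed
    have growth: "norm (g r) \<le> L * norm (u r)" if r: "r \<in> {t0..T}" and "norm (u r) \<le> 1" for r
    proof -
      have "norm (y r) \<le> B + 1"
        using that B[OF r] norm_triangle_sub[of "y r" "x r"] by (simp add: u_def)
      then show ?thesis
        using lipschitz_onD[OF L[OF r], of "y r" "x r"] B[OF r]
        by (simp add: g_def u_def dist_norm)
    qed
    have scaled: "norm (u s) * M < min 1 e"
      using close \<open>0 < M\<close> by (simp add: d_def u_def dist_norm pos_less_divide_eq)
    have expM: "norm (u s) * exp (L * c) \<le> norm (u s) * M" if "c \<le> T - t0" for c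
      using that \<open>0 \<le> L\<close> unfolding M_def by (intro mult_left_mono) (auto intro: mult_left_mono)
    have "norm (u t) \<le> norm (u s) * exp (L * \<bar>t - s\<bar>)"
    proof (cases "s \<le> t")
      case True
      have "norm (u t) \<le> norm (u s) * exp (L * (t - s))"
        by (rule gronwall_unit_ball[where b = t, OF der growth])
           (use s t True \<open>0 \<le> L\<close> expM[of "t - s"] scaled in auto)
      with True show ?thesis by simp
    next
      case False
      have "norm (u t) \<le> norm (u s) * exp (L * (s - t))"
        by (rule gronwall_unit_ball_backward[where a = t, OF der growth])
           (use s t False \<open>0 \<le> L\<close> expM[of "s - t"] scaled in auto)
      with False show ?thesis by simp
    qed
    also have "\<dots> \<le> norm (u s) * M" using s t by (intro expM) auto
    finally show "dist (y t) (x t) < e" using scaled by (simp add: u_def dist_norm)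
  qed
qed

section \<open>The flow and its joint continuity\<close>

lemma ode_flow_eq:
  assumes "\<And>y. ode_solution f t0 T y \<Longrightarrow> y s = x s \<Longrightarrow> y t = x t"
    and "ode_solution f t0 T x"
  shows "ode_flow f t0 T t (x s) s = x t"
  unfolding ode_flow_def using assms by (intro the_equality) blast+

text \<open>Solutions through (\<xi>, s) and (\<eta>, r) are compared at the common time
  \<open>r\<close>: there they differ by at most the distance from \<eta> to \<xi> plus the distance
  from \<open>x s\<close> to \<open>x r\<close>, each below \<open>d / 2\<close>. The uniform
  \<open>d\<close> carries this closeness from \<open>r\<close> to \<open>t\<close>.\<close>

lemma ode_flow_continuous_on:
  fixes f :: "(real ^ 'n) \<Rightarrow> real \<Rightarrow> real ^ 'n"
  assumes f_continuous: "continuous_on (UNIV \<times> {t0..T}) (\<lambda>(x, t). f x t)"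
    and f_lipschitz: "local_lipschitz {t0..T} UNIV (\<lambda>t x. f x t)"
    and solution_exists: "\<And>s \<xi>. s \<in> {t0..T} \<Longrightarrow> \<exists>x. ode_solution f t0 T x \<and> x s = \<xi>"
    and flow: "\<And>x s t. ode_solution f t0 T x \<Longrightarrow> s \<in> {t0..T} \<Longrightarrow> t \<in> {t0..T} \<Longrightarrow>
           ode_flow f t0 T t (x s) s = x t"
    and t: "t \<in> {t0..T}"
  shows "continuous_on (UNIV \<times> {t0..T}) (\<lambda>(\<xi>, s). ode_flow f t0 T t \<xi> s)"
  unfolding continuous_on_iff
proof (intro ballI allI impI)
  fix p :: "(real ^ 'n) \<times> real" and e :: real
  assume p: "p \<in> UNIV \<times> {t0..T}" and "0 < e"
  obtain \<xi> s where [simp]: "p = (\<xi>, s)" by (cases p)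
  have s: "s \<in> {t0..T}" using p by simp
  obtain x where x: "ode_solution f t0 T x" "x s = \<xi>" using solution_exists[OF s] by blast
  obtain d where "0 < d" and d: "\<And>y r t. ode_solution f t0 T y \<Longrightarrow> r \<in> {t0..T} \<Longrightarrow>
      t \<in> {t0..T} \<Longrightarrow> dist (y r) (x r) < d \<Longrightarrow> dist (y t) (x t) < e"
    using ode_solution_continuous_dependence[OF f_continuous f_lipschitz x(1) \<open>0 < e\<close>] by blast
  obtain c where "0 < c"
    and c: "\<And>r. r \<in> {t0..T} \<Longrightarrow> dist r s < c \<Longrightarrow> dist (x r) (x s) < d / 2"
    using ode_solution_continuous_on[OF x(1)] s \<open>0 < d\<close> unfolding continuous_on_iff
    by (metis half_gt_zero)
  have "dist (ode_flow f t0 T t \<eta> r) (ode_flow f t0 T t \<xi> s) < e"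
    if r: "r \<in> {t0..T}" and close: "dist (\<eta>, r) (\<xi>, s) < min c (d / 2)" for \<eta> r
  proof -
    obtain y where y: "ode_solution f t0 T y" "y r = \<eta>" using solution_exists[OF r] by blast
    have "dist r s < c" "dist \<eta> \<xi> < d / 2"
      using close dist_snd_le[of "(\<eta>, r)" "(\<xi>, s)"] dist_fst_le[of "(\<eta>, r)" "(\<xi>, s)"] by auto
    then have "dist (y r) (x r) < d"
      using c[OF r] dist_triangle_half_r[of \<xi> \<eta> d "x r"] x(2) y(2) by (simp add: dist_commute)
    then have "dist (y t) (x t) < e" using d y(1) r t by blast
    then show ?thesis using flow[OF y(1) r t] flow[OF x(1) s t] x(2) y(2) by simp
  qed
  then show "\<exists>d>0. \<forall>q\<in>UNIV \<times> {t0..T}. dist q p < d \<longrightarrow>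
      dist (case q of (\<xi>, s) \<Rightarrow> ode_flow f t0 T t \<xi> s) (case p of (\<xi>, s) \<Rightarrow> ode_flow f t0 T t \<xi> s) < e"
    using \<open>0 < c\<close> \<open>0 < d\<close> by (intro exI[of _ "min c (d / 2)"]) auto
qed

section \<open>Stability and Lyapunov functions\<close>

theorem theorem3p1:
  fixes f :: "(real ^ 'n) \<Rightarrow> real \<Rightarrow> real ^ 'n"
    and \<Phi> :: "real \<Rightarrow> (real ^ 'n) set"
    and G0 :: "(real ^ 'n) set"
    and t0 T :: real
  assumes "t0 < T"
    and f_continuous: "continuous_on (UNIV \<times> {t0..T}) (\<lambda>(x, t). f x t)"
    and f_lipschitz: "local_lipschitz {t0..T} UNIV (\<lambda>t x. f x t)"
    and solution_exists: "\<And>s \<xi>. s \<in> {t0..T} \<Longrightarrow> \<exists>x. ode_solution f t0 T x \<and> x s = \<xi>"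
    and solution_unique: "\<And>s x y t. s \<in> {t0..T} \<Longrightarrow> ode_solution f t0 T x \<Longrightarrow>
          ode_solution f t0 T y \<Longrightarrow> x s = y s \<Longrightarrow> t \<in> {t0..T} \<Longrightarrow> x t = y t"
    and f_zero: "\<And>t. t \<in> {t0..T} \<Longrightarrow> f 0 t = 0"
    and \<Phi>_compact: "\<And>t. t \<in> {t0..T} \<Longrightarrow> compact (\<Phi> t)"
    and \<Phi>_zero: "\<And>t. t \<in> {t0..T} \<Longrightarrow> 0 \<in> \<Phi> t"
    and G0_subset: "G0 \<subseteq> \<Phi> t0"
    and G0_zero: "0 \<in> G0"
  shows "practically_stable f G0 \<Phi> t0 T \<longleftrightarrow>
    (\<exists>V :: (real ^ 'n) \<Rightarrow> real \<Rightarrow> real.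
       continuous_on (UNIV \<times> {t0..T}) (\<lambda>(x, t). V x t) \<and>
       (\<forall>x. ode_solution f t0 T x \<longrightarrow> antimono_on {t0..T} (\<lambda>t. V (x t) t)) \<and>
       (\<forall>t\<in>{t0..T}. {x. V x t \<le> 1} \<subseteq> \<Phi> t) \<and>
       G0 \<subseteq> {x. V x t0 \<le> 1})"
proof
  have flow: "ode_flow f t0 T t (x s) s = x t"
    if "ode_solution f t0 T x" "s \<in> {t0..T}" "t \<in> {t0..T}" for x s t
    using that by (intro ode_flow_eq) (auto intro: solution_unique[of s])
  have t0: "t0 \<in> {t0..T}" using \<open>t0 < T\<close> by simp
  have flow_cont: "continuous_on (UNIV \<times> {t0..T}) (\<lambda>(\<xi>, s). ode_flow f t0 T t \<xi> s)"
    if "t \<in> {t0..T}" for t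
    by (rule ode_flow_continuous_on[OF f_continuous f_lipschitz solution_exists flow that])
  {
    assume stable: "practically_stable f G0 \<Phi> t0 T"
    define V where "V x t = 1 + infdist (ode_flow f t0 T t0 x t) G0" for x t
    have "continuous_on (UNIV \<times> {t0..T}) (\<lambda>(x, t). V x t)"
      using flow_cont[OF t0] unfolding V_def case_prod_beta
      by (intro continuous_intros) auto
    moreover have "antimono_on {t0..T} (\<lambda>t. V (x t) t)" if "ode_solution f t0 T x" for x
      using flow[OF that _ t0] by (auto simp: V_def monotone_on_def)
    moreover have "x \<in> \<Phi> t" if t: "t \<in> {t0..T}" and "V x t \<le> 1" for x t
    proof -
      obtain z where z: "ode_solution f t0 T z" "z t = x" using solution_exists[OF t] by blast
      have "infdist (z t0) G0 = 0"
        using \<open>V x t \<le> 1\<close> flow[OF z(1) t t0] z(2) infdist_nonneg[of "z t0" G0]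
        by (simp add: V_def)
      \<comment> \<open>\<open>G0_zero\<close> supplies nonemptiness: \<open>infdist\<close> to the
        empty set is 0 by convention, so distance zero would then say nothing.\<close>
      then have "z t0 \<in> closure G0"
        using G0_zero by (subst in_closure_iff_infdist_zero) auto
      \<comment> \<open>Stability speaks only of starting points in \<open>G0\<close>; continuity of
        the flow and closedness of \<Phi> t extend the inclusion to limits of such points.\<close>
      moreover have "(\<lambda>\<xi>. ode_flow f t0 T t \<xi> t0) ` closure G0 \<subseteq> \<Phi> t"
      proof (rule image_closure_subset)
        have "continuous_on (closure G0) (\<lambda>\<xi>. (\<xi>, t0))" by (intro continuous_intros)
        then show "continuous_on (closure G0) (\<lambda>\<xi>. ode_flow f t0 T t \<xi> t0)"
          using continuous_on_compose2[OF flow_cont[OF t], of "closure G0" "\<lambda>\<xi>. (\<xi>, t0)"] t0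
          by (simp add: image_subset_iff)
        show "closed (\<Phi> t)" using \<Phi>_compact[OF t] by (rule compact_imp_closed)
        show "(\<lambda>\<xi>. ode_flow f t0 T t \<xi> t0) ` G0 \<subseteq> \<Phi> t"
          using stable t by (auto simp: practically_stable_def)
      qed
      ultimately show "x \<in> \<Phi> t" using flow[OF z(1) t0 t] z(2) by auto
    qed
    moreover have "V x t0 \<le> 1" if "x \<in> G0" for x
    proof -
      obtain z where "ode_solution f t0 T z" "z t0 = x" using solution_exists[OF t0] by blast
      then show ?thesis using flow[OF _ t0 t0] that by (force simp: V_def)
    qed
    ultimately show "\<exists>V. continuous_on (UNIV \<times> {t0..T}) (\<lambda>(x, t). V x t) \<and>
       (\<forall>x. ode_solution f t0 T x \<longrightarrow> antimono_on {t0..T} (\<lambda>t. V (x t) t)) \<and>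
       (\<forall>t\<in>{t0..T}. {x. V x t \<le> (1 :: real)} \<subseteq> \<Phi> t) \<and> G0 \<subseteq> {x. V x t0 \<le> 1}"
      by (intro exI[of _ V]) auto
  }
  {
    assume "\<exists>V. continuous_on (UNIV \<times> {t0..T}) (\<lambda>(x, t). V x t) \<and>
       (\<forall>x. ode_solution f t0 T x \<longrightarrow> antimono_on {t0..T} (\<lambda>t. V (x t) t)) \<and>
       (\<forall>t\<in>{t0..T}. {x. V x t \<le> (1 :: real)} \<subseteq> \<Phi> t) \<and> G0 \<subseteq> {x. V x t0 \<le> 1}"
    then obtain V :: "real ^ 'n \<Rightarrow> real \<Rightarrow> real" where
      mono: "\<And>x. ode_solution f t0 T x \<Longrightarrow> antimono_on {t0..T} (\<lambda>t. V (x t) t)"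
      and V\<Phi>: "\<And>t. t \<in> {t0..T} \<Longrightarrow> {x. V x t \<le> 1} \<subseteq> \<Phi> t"
      and VG0: "G0 \<subseteq> {x. V x t0 \<le> 1}" by blast
    show "practically_stable f G0 \<Phi> t0 T"
      unfolding practically_stable_def
    proof (intro ballI)
      fix x0 t assume "x0 \<in> G0" and t: "t \<in> {t0..T}"
      obtain x where x: "ode_solution f t0 T x" "x t0 = x0" using solution_exists[OF t0] by blast
      have "V (x t) t \<le> V (x t0) t0"
        using monotone_onD[OF mono[OF x(1)] t0 t] t by simp
      also have "\<dots> \<le> 1" using \<open>x0 \<in> G0\<close> VG0 x(2) by auto
      finally show "ode_flow f t0 T t x0 t0 \<in> \<Phi> t"
        using V\<Phi>[OF t] flow[OF x(1) t0 t] x(2) by auto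
    qed
  }
qed

end
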